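(* Let $(\Omega,\Sigma,\mu)$ be an atomless probability space, let $T:\Omega\to\Omega$ be an ergodic invertible measure-preserving transformation, and let $(a_k)_{k\in\mathbb{Z}}$ be a sequence of positive real numbers with $\sum_{k\in\mathbb{Z}}a_k=1$ and $\sum_{k\in\mathbb{Z}}\sqrt{a_k}<\infty$. Then the norm $$|||f|||=\int_\Omega\Big(\sum_{k\in\mathbb{Z}}a_k|f(T^k\omega)|^2\Big)^{1/2}d\mu(\omega)$$ on $L_1(\mu)$ is not midpoint locally uniformly rotund (MLUR).
   Context: $L_1(\mu)$ is over $\mathbb{K}=\mathbb{R}$ or $\mathbb{C}$. An invertible measure-preserving transformation is a bijection $T:\Omega\to\Omega$ such that $T$ and $T^{-1}$ are measurable and $\mu(T^{-1}(A))=\mu(A)$ for every $A\in\Sigma$. It is ergodic if every $A\in\Sigma$ with $\mu(A\,\Delta\,T^{-1}(A))=0$ satisfies $\mu(A)=0$ or $\mu(A)=1$. The functional $|||\cdot|||$ is an equivalent norm on $L_1(\mu)$, with $\|f\|_1\le|||f|||\le(\sum_{k}\sqrt{a_k})\|f\|_1$. A Banach space $X$ with unit sphere $S_X$ (or its norm) is MLUR if, whenever $x\in S_X$ and $(h_n)\subseteq X$ satisfy $\|x+h_n\|\to1$ and $\|x-h_n\|\to1$, then $\|h_n\|\to0$. *)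

theory Defs
  imports "HOL-Probability.Probability"
begin

section \<open>Ergodic invertible measure-preserving transformations\<close>

definition atomless :: "'a measure \<Rightarrow> bool" where
  "atomless M \<longleftrightarrow>
     (\<forall>A\<in>sets M. 0 < emeasure M A \<longrightarrow>
        (\<exists>B\<in>sets M. B \<subseteq> A \<and> 0 < emeasure M B \<and> emeasure M B < emeasure M A))"

text \<open>
  Only the values of \<open>T\<close> on \<^term>\<open>space M\<close> matter, and the inverse transformation is
  \<^term>\<open>inv_into (space M) T\<close>.
\<close>

definition invertible_measure_preserving :: "'a measure \<Rightarrow> ('a \<Rightarrow> 'a) \<Rightarrow> bool" where
  "invertible_measure_preserving M T \<longleftrightarrow>
     bij_betw T (space M) (space M) \<and>
     T \<in> M \<rightarrow>\<^sub>M M \<and>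
     inv_into (space M) T \<in> M \<rightarrow>\<^sub>M M \<and>
     (\<forall>A\<in>sets M. emeasure M (T -` A \<inter> space M) = emeasure M A)"

definition ergodic :: "'a measure \<Rightarrow> ('a \<Rightarrow> 'a) \<Rightarrow> bool" where
  "ergodic M T \<longleftrightarrow>
     (\<forall>A\<in>sets M.
        emeasure M ((A - (T -` A \<inter> space M)) \<union> ((T -` A \<inter> space M) - A)) = 0 \<longrightarrow>
        emeasure M A = 0 \<or> emeasure M A = 1)"

definition iterate :: "'a measure \<Rightarrow> ('a \<Rightarrow> 'a) \<Rightarrow> int \<Rightarrow> 'a \<Rightarrow> 'a" where
  "iterate M T k =
     (if 0 \<le> k then T ^^ nat k else inv_into (space M) T ^^ nat (- k))"


section \<open>The space \<open>L\<^sub>1\<close> of classes of integrable functions\<close>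

definition ae_eq_rel ::
    "'a measure \<Rightarrow> (('a \<Rightarrow> 'b::{banach, second_countable_topology}) \<times> ('a \<Rightarrow> 'b)) set" where
  "ae_eq_rel M = {(f, g). integrable M f \<and> integrable M g \<and> (AE x in M. f x = g x)}"

definition L1 ::
    "'a measure \<Rightarrow> ('a \<Rightarrow> 'b::{banach, second_countable_topology}) set set" where
  "L1 M = {f. integrable M f} // ae_eq_rel M"

definition L1_class ::
    "'a measure \<Rightarrow> ('a \<Rightarrow> 'b::{banach, second_countable_topology}) \<Rightarrow> ('a \<Rightarrow> 'b) set" where
  "L1_class M f = ae_eq_rel M `` {f}"

text \<open>
  The operations on classes are computed on chosen representatives; independence of the choice
  is proved in \<open>L1_add_class\<close>, \<open>L1_diff_class\<close> and \<open>orbit_norm_class\<close> below.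
\<close>

definition L1_rep :: "('a \<Rightarrow> 'b) set \<Rightarrow> 'a \<Rightarrow> 'b" where
  "L1_rep X = (SOME f. f \<in> X)"

definition L1_add :: "'a measure \<Rightarrow> ('a \<Rightarrow> 'b::{banach, second_countable_topology}) set
    \<Rightarrow> ('a \<Rightarrow> 'b) set \<Rightarrow> ('a \<Rightarrow> 'b) set" where
  "L1_add M X Y = L1_class M (\<lambda>\<omega>. L1_rep X \<omega> + L1_rep Y \<omega>)"

definition L1_diff :: "'a measure \<Rightarrow> ('a \<Rightarrow> 'b::{banach, second_countable_topology}) set
    \<Rightarrow> ('a \<Rightarrow> 'b) set \<Rightarrow> ('a \<Rightarrow> 'b) set" where
  "L1_diff M X Y = L1_class M (\<lambda>\<omega>. L1_rep X \<omega> - L1_rep Y \<omega>)"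

text \<open>
  If \<open>f\<close> is integrable and \<open>\<Sum>k. sqrt (a k) < \<infinity>\<close>, then
  \<open>\<Sum>k. sqrt (a k) * norm (f (T\<^sup>k \<omega>))\<close>, which dominates the integrand, is integrable. Hence the
  inner sum converges almost everywhere and the value 0 that \<^const>\<open>infsum\<close> takes on divergent
  sums plays no role; the integrand is integrable by \<open>integrable_orbit_sum\<close> below.
\<close>

definition orbit_integral ::
    "'a measure \<Rightarrow> ('a \<Rightarrow> 'a) \<Rightarrow> (int \<Rightarrow> real) \<Rightarrow> ('a \<Rightarrow> 'b::real_normed_vector) \<Rightarrow> real" where
  "orbit_integral M T a f =
     (\<integral>\<omega>. sqrt (\<Sum>\<^sub>\<infinity>k. a k * (norm (f (iterate M T k \<omega>)))\<^sup>2) \<partial>M)"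

definition orbit_norm ::
    "'a measure \<Rightarrow> ('a \<Rightarrow> 'a) \<Rightarrow> (int \<Rightarrow> real) \<Rightarrow> ('a \<Rightarrow> 'b::real_normed_vector) set \<Rightarrow> real" where
  "orbit_norm M T a X = orbit_integral M T a (L1_rep X)"


section \<open>Midpoint local uniform rotundity\<close>

text \<open>
  The normed space is given by its carrier \<open>X\<close>, addition \<open>add\<close>, subtraction \<open>diff\<close> and
  norm \<open>N\<close>.
\<close>

definition MLUR ::
    "'v set \<Rightarrow> ('v \<Rightarrow> 'v \<Rightarrow> 'v) \<Rightarrow> ('v \<Rightarrow> 'v \<Rightarrow> 'v) \<Rightarrow> ('v \<Rightarrow> real) \<Rightarrow> bool" where
  "MLUR X add diff N \<longleftrightarrow>
     (\<forall>x\<in>X. \<forall>h::nat \<Rightarrow> 'v.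
        N x = 1 \<longrightarrow> (\<forall>n. h n \<in> X) \<longrightarrow>
        (\<lambda>n. N (add x (h n))) \<longlonglongrightarrow> 1 \<longrightarrow>
        (\<lambda>n. N (diff x (h n))) \<longlonglongrightarrow> 1 \<longrightarrow>
        (\<lambda>n. N (h n)) \<longlonglongrightarrow> 0)"


section \<open>Independence of representatives\<close>

lemma equiv_ae_eq_rel: "equiv {f. integrable M f} (ae_eq_rel M)"
  unfolding equiv_def refl_on_def sym_def trans_def ae_eq_rel_def
  by (auto elim: AE_mp)

lemma L1_rep_class:
  assumes "integrable M f"
  shows "integrable M (L1_rep (L1_class M f))" "AE x in M. L1_rep (L1_class M f) x = f x"
proof -
  have "f \<in> L1_class M f"
    using assms by (simp add: L1_class_def ae_eq_rel_def)
  then have "L1_rep (L1_class M f) \<in> L1_class M f"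
    unfolding L1_rep_def by (rule someI[where P = "\<lambda>h. h \<in> L1_class M f"])
  then show "integrable M (L1_rep (L1_class M f))" "AE x in M. L1_rep (L1_class M f) x = f x"
    by (auto simp: L1_class_def ae_eq_rel_def elim: AE_mp)
qed

lemma L1_class_eqI:
  assumes "integrable M f" "integrable M g" "AE x in M. f x = g x"
  shows "L1_class M f = L1_class M g"
  unfolding L1_class_def
  by (rule equiv_class_eq[OF equiv_ae_eq_rel]) (use assms in \<open>simp add: ae_eq_rel_def\<close>)

lemma L1_add_class:
  assumes "integrable M f" "integrable M g"
  shows "L1_add M (L1_class M f) (L1_class M g) = L1_class M (\<lambda>\<omega>. f \<omega> + g \<omega>)"
  unfolding L1_add_def
proof (rule L1_class_eqI)
  show "AE x in M. L1_rep (L1_class M f) x + L1_rep (L1_class M g) x = f x + g x"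
    using L1_rep_class(2)[OF assms(1)] L1_rep_class(2)[OF assms(2)] by eventually_elim simp
qed (use assms L1_rep_class in auto)

lemma L1_diff_class:
  assumes "integrable M f" "integrable M g"
  shows "L1_diff M (L1_class M f) (L1_class M g) = L1_class M (\<lambda>\<omega>. f \<omega> - g \<omega>)"
  unfolding L1_diff_def
proof (rule L1_class_eqI)
  show "AE x in M. L1_rep (L1_class M f) x - L1_rep (L1_class M g) x = f x - g x"
    using L1_rep_class(2)[OF assms(1)] L1_rep_class(2)[OF assms(2)] by eventually_elim simp
qed (use assms L1_rep_class in auto)

lemma measurable_distr_funpow:
  assumes "S \<in> M \<rightarrow>\<^sub>M M" "distr M M S = M"
  shows "S ^^ n \<in> M \<rightarrow>\<^sub>M M \<and> distr M M (S ^^ n) = M"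
proof (induction n)
  case 0
  then show ?case by (simp add: id_def distr_id)
next
  case (Suc n)
  then have "distr (distr M M (S ^^ n)) M S = distr M M (S \<circ> S ^^ n)"
    using assms(1) by (intro distr_distr) auto
  then have "distr M M (S ^^ Suc n) = M"
    using Suc assms(2) by (simp only: funpow.simps)
  moreover have "S ^^ Suc n \<in> M \<rightarrow>\<^sub>M M"
    using Suc assms(1) by (auto intro: measurable_comp)
  ultimately show ?case by (rule conjI[rotated])
qed

lemma iterate_measure_preserving:
  assumes "invertible_measure_preserving M T"
  shows "iterate M T k \<in> M \<rightarrow>\<^sub>M M" "distr M M (iterate M T k) = M"
proof -
  let ?S = "inv_into (space M) T"
  have bij: "bij_betw T (space M) (space M)"
    and T: "T \<in> M \<rightarrow>\<^sub>M M" and S: "?S \<in> M \<rightarrow>\<^sub>M M"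
    and pres: "\<And>A. A \<in> sets M \<Longrightarrow> emeasure M (T -` A \<inter> space M) = emeasure M A"
    using assms by (auto simp: invertible_measure_preserving_def)
  have dT: "distr M M T = M"
    by (rule measure_eqI) (auto simp: emeasure_distr[OF T] pres)
  have "distr M M ?S = distr (distr M M T) M ?S"
    by (simp add: dT)
  also have "\<dots> = distr M M (?S \<circ> T)"
    by (rule distr_distr[OF S T])
  also have "\<dots> = distr M M (\<lambda>x. x)"
    using bij by (intro distr_cong) (auto simp: bij_betw_def)
  finally have dS: "distr M M ?S = M"
    by (simp add: distr_id)
  show "iterate M T k \<in> M \<rightarrow>\<^sub>M M" "distr M M (iterate M T k) = M"
    using measurable_distr_funpow[OF T dT] measurable_distr_funpow[OF S dS]
    by (auto simp: iterate_def)
qed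

lemma borel_measurable_infsum_nonneg:
  fixes f :: "'i::countable \<Rightarrow> 'a \<Rightarrow> real"
  assumes meas: "\<And>k. f k \<in> borel_measurable M" and nonneg: "\<And>k x. 0 \<le> f k x"
  shows "(\<lambda>x. \<Sum>\<^sub>\<infinity>k. f k x) \<in> borel_measurable M"
proof -
  have eq: "(\<Sum>\<^sub>\<infinity>k. f k x) =
      enn2real (SUP F\<in>{F. finite F}. ennreal (\<Sum>k\<in>F. f k x))" for x
  proof (cases "(\<lambda>k. f k x) summable_on UNIV")
    case True
    have "ennreal (\<Sum>\<^sub>\<infinity>k. f k x) = (SUP F\<in>{F. finite F}. ennreal (\<Sum>k\<in>F. f k x))"
      using infsum_nonneg_is_SUPREMUM_ennreal[OF True] nonneg by simp
    then show ?thesis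
      by (metis enn2real_ennreal infsum_nonneg nonneg)
  next
    case False
    have "(SUP F\<in>{F. finite F}. ennreal (\<Sum>k\<in>F. f k x)) = top"
    proof (rule ccontr)
      let ?s = "SUP F\<in>{F. finite F}. ennreal (\<Sum>k\<in>F. f k x)"
      assume fin: "?s \<noteq> top"
      have "(\<Sum>k\<in>F. f k x) \<le> enn2real ?s" if "finite F" for F
      proof -
        have "ennreal (\<Sum>k\<in>F. f k x) \<le> ?s"
          using that by (intro SUP_upper) auto
        then have "enn2real (ennreal (\<Sum>k\<in>F. f k x)) \<le> enn2real ?s"
          by (rule enn2real_mono) (use fin top.not_eq_extremum in blast)
        then show ?thesis
          using nonneg by (simp add: sum_nonneg)
      qed
      then have "bdd_above (sum (\<lambda>k. f k x) ` {F. F \<subseteq> UNIV \<and> finite F})"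
        by (auto simp: bdd_above_def)
      then have "(\<lambda>k. f k x) summable_on UNIV"
        using nonneg by (intro nonneg_bdd_above_summable_on) auto
      with False show False by simp
    qed
    then show ?thesis
      using infsum_not_exists[OF False] by (simp only: enn2real_top)
  qed
  have "countable {F :: 'i set. finite F}"
    using countable_Collect_finite by simp
  then have "(\<lambda>x. SUP F\<in>{F. finite F}. ennreal (\<Sum>k\<in>F. f k x)) \<in> borel_measurable M"
    using meas by (intro borel_measurable_SUP) auto
  then show ?thesis
    unfolding eq by measurable
qed

lemma borel_measurable_orbit_sum:
  fixes u :: "'a \<Rightarrow> 'b::{banach, second_countable_topology}"
  assumes T: "invertible_measure_preserving M T" and a: "\<And>k. 0 \<le> a k"
    and [measurable]: "integrable M u"
  shows "(\<lambda>\<omega>. sqrt (\<Sum>\<^sub>\<infinity>k. a k * (norm (u (iterate M T k \<omega>)))\<^sup>2)) \<in> borel_measurable M"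
proof -
  have [measurable]: "iterate M T k \<in> M \<rightarrow>\<^sub>M M" for k
    by (rule iterate_measure_preserving[OF T])
  have "(\<lambda>\<omega>. \<Sum>\<^sub>\<infinity>k. a k * (norm (u (iterate M T k \<omega>)))\<^sup>2) \<in> borel_measurable M"
    by (rule borel_measurable_infsum_nonneg) (use a in auto)
  then show ?thesis by measurable
qed

lemma sqrt_infsum_squares_le:
  fixes b :: "int \<Rightarrow> real"
  assumes b: "\<And>k. 0 \<le> b k"
  shows "ennreal (sqrt (\<Sum>\<^sub>\<infinity>k. (b k)\<^sup>2)) \<le> (\<integral>\<^sup>+k. ennreal (b k) \<partial>count_space UNIV)"
proof (cases "(\<integral>\<^sup>+k. ennreal (b k) \<partial>count_space UNIV) = top")
  case False
  then have int: "integrable (count_space UNIV) b"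
    using b by (intro integrableI_nonneg) (auto simp: top.not_eq_extremum)
  let ?s = "\<integral>k. b k \<partial>count_space UNIV"
  have s: "(\<integral>\<^sup>+k. ennreal (b k) \<partial>count_space UNIV) = ennreal ?s"
    using int b by (intro nn_integral_eq_integral) auto
  have s0: "0 \<le> ?s"
    by (rule Bochner_Integration.integral_nonneg) (rule b)
  have "(\<Sum>\<^sub>\<infinity>k. (b k)\<^sup>2) \<le> ?s\<^sup>2"
  proof (cases "(\<lambda>k. (b k)\<^sup>2) summable_on UNIV")
    case True
    show ?thesis
    proof (rule infsum_le_finite_sums[OF True])
      fix F :: "int set" assume F: "finite F"
      have "(\<Sum>k\<in>F. (b k)\<^sup>2) \<le> (\<Sum>k\<in>F. b k * (\<Sum>k\<in>F. b k))"
        unfolding power2_eq_square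
        using b F by (intro sum_mono mult_left_mono member_le_sum) auto
      also have "\<dots> = (\<Sum>k\<in>F. b k)\<^sup>2"
        by (simp add: sum_distrib_right power2_eq_square)
      also have "(\<Sum>k\<in>F. b k) \<le> ?s"
      proof -
        have "ennreal (\<Sum>k\<in>F. b k) = (\<integral>\<^sup>+k. ennreal (b k) \<partial>count_space F)"
          using F b by (simp add: nn_integral_count_space_finite sum_ennreal)
        also have "\<dots> = (\<integral>\<^sup>+k. ennreal (b k) * indicator F k \<partial>count_space UNIV)"
          by (simp add: nn_integral_count_space_indicator)
        also have "\<dots> \<le> (\<integral>\<^sup>+k. ennreal (b k) \<partial>count_space UNIV)"
          by (intro nn_integral_mono) (auto simp: indicator_def)
        finally show ?thesis
          unfolding s using s0 by simp
      qed
      then have "(\<Sum>k\<in>F. b k)\<^sup>2 \<le> ?s\<^sup>2"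
        using b by (intro power_mono sum_nonneg) auto
      finally show "(\<Sum>k\<in>F. (b k)\<^sup>2) \<le> ?s\<^sup>2" .
    qed
  qed (simp add: infsum_not_exists)
  then have "sqrt (\<Sum>\<^sub>\<infinity>k. (b k)\<^sup>2) \<le> ?s"
    using s0 by (simp add: real_le_lsqrt)
  then show ?thesis
    unfolding s by (rule ennreal_leI)
qed simp

lemma integrable_orbit_sum:
  fixes f :: "'a \<Rightarrow> 'b::{banach, second_countable_topology}"
  assumes T: "invertible_measure_preserving M T" and a: "\<And>k. 0 \<le> a k"
    and sa: "(\<lambda>k. sqrt (a k)) summable_on UNIV" and f: "integrable M f"
  shows "integrable M (\<lambda>\<omega>. sqrt (\<Sum>\<^sub>\<infinity>k. a k * (norm (f (iterate M T k \<omega>)))\<^sup>2))"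
proof (rule integrableI_bounded)
  show "(\<lambda>\<omega>. sqrt (\<Sum>\<^sub>\<infinity>k. a k * (norm (f (iterate M T k \<omega>)))\<^sup>2)) \<in> borel_measurable M"
    by (rule borel_measurable_orbit_sum[OF T a f])
  note [measurable] = f iterate_measure_preserving(1)[OF T]
  let ?b = "\<lambda>\<omega> k. sqrt (a k) * norm (f (iterate M T k \<omega>))"
  let ?C = "\<integral>\<^sup>+\<omega>. ennreal (norm (f \<omega>)) \<partial>M"
  have "(\<integral>\<^sup>+\<omega>. ennreal (norm (sqrt (\<Sum>\<^sub>\<infinity>k. a k * (norm (f (iterate M T k \<omega>)))\<^sup>2))) \<partial>M)
      \<le> (\<integral>\<^sup>+\<omega>. (\<integral>\<^sup>+k. ennreal (?b \<omega> k) \<partial>count_space UNIV) \<partial>M)"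
  proof (rule nn_integral_mono)
    fix \<omega>
    have "(\<Sum>\<^sub>\<infinity>k. a k * (norm (f (iterate M T k \<omega>)))\<^sup>2) = (\<Sum>\<^sub>\<infinity>k. (?b \<omega> k)\<^sup>2)"
      using a by (simp add: power_mult_distrib)
    moreover have "0 \<le> (\<Sum>\<^sub>\<infinity>k. (?b \<omega> k)\<^sup>2)"
      by (intro infsum_nonneg) auto
    ultimately show "ennreal (norm (sqrt (\<Sum>\<^sub>\<infinity>k. a k * (norm (f (iterate M T k \<omega>)))\<^sup>2)))
        \<le> (\<integral>\<^sup>+k. ennreal (?b \<omega> k) \<partial>count_space UNIV)"
      using sqrt_infsum_squares_le[of "?b \<omega>"] a by simp
  qed
  also have "\<dots> = (\<integral>\<^sup>+k. (\<integral>\<^sup>+\<omega>. ennreal (?b \<omega> k) \<partial>M) \<partial>count_space UNIV)"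
    by (intro nn_integral_count_space_nn_integral) auto
  also have "\<dots> = (\<integral>\<^sup>+k. ennreal (sqrt (a k)) * ?C \<partial>count_space UNIV)"
  proof (rule nn_integral_cong)
    fix k
    have "(\<integral>\<^sup>+\<omega>. ennreal (norm (f (iterate M T k \<omega>))) \<partial>M) =
        (\<integral>\<^sup>+\<omega>. ennreal (norm (f \<omega>)) \<partial>distr M M (iterate M T k))"
      by (simp add: nn_integral_distr)
    also have "\<dots> = ?C"
      by (simp only: iterate_measure_preserving(2)[OF T])
    finally show "(\<integral>\<^sup>+\<omega>. ennreal (?b \<omega> k) \<partial>M) = ennreal (sqrt (a k)) * ?C"
      using a by (simp add: ennreal_mult nn_integral_cmult)
  qed
  also have "\<dots> = (\<integral>\<^sup>+k. ennreal (sqrt (a k)) \<partial>count_space UNIV) * ?C"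
    by (simp add: nn_integral_multc)
  also have "\<dots> < \<infinity>"
  proof -
    have "Infinite_Set_Sum.abs_summable_on (\<lambda>k. sqrt (a k)) UNIV"
      using sa a by (simp add: abs_summable_equivalent[symmetric])
    then have "(\<integral>\<^sup>+k. ennreal (sqrt (a k)) \<partial>count_space UNIV) < \<infinity>"
      using a by (simp add: Infinite_Set_Sum.abs_summable_on_def integrable_iff_bounded)
    moreover have "?C < \<infinity>"
      using f by (simp add: integrable_iff_bounded)
    ultimately show ?thesis
      by (simp add: ennreal_mult_less_top)
  qed
  finally show "(\<integral>\<^sup>+\<omega>. ennreal (norm (sqrt (\<Sum>\<^sub>\<infinity>k. a k * (norm (f (iterate M T k \<omega>)))\<^sup>2))) \<partial>M) < \<infinity>" .
qed

lemma orbit_norm_class: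
  fixes f :: "'a \<Rightarrow> 'b::{banach, second_countable_topology}"
  assumes T: "invertible_measure_preserving M T" and a: "\<And>k. 0 \<le> a k"
    and f: "integrable M f"
  shows "orbit_norm M T a (L1_class M f) = orbit_integral M T a f"
proof -
  note it = iterate_measure_preserving[OF T]
  let ?g = "L1_rep (L1_class M f)"
  have g: "integrable M ?g" and ae: "AE x in M. ?g x = f x"
    using L1_rep_class[OF f] by auto
  have meas: "(\<lambda>\<omega>. sqrt (\<Sum>\<^sub>\<infinity>k. a k * (norm (u (iterate M T k \<omega>)))\<^sup>2)) \<in> borel_measurable M"
    if "integrable M u" for u :: "'a \<Rightarrow> 'b"
    using borel_measurable_orbit_sum[OF T a that] .
  have "AE \<omega> in M. ?g (iterate M T k \<omega>) = f (iterate M T k \<omega>)" for k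
  proof (rule AE_distrD[OF it(1)])
    show "AE x in distr M M (iterate M T k). ?g x = f x"
      unfolding it(2) by (rule ae)
  qed
  then have "AE \<omega> in M. \<forall>k. ?g (iterate M T k \<omega>) = f (iterate M T k \<omega>)"
    by (simp add: AE_all_countable)
  then have "AE \<omega> in M. sqrt (\<Sum>\<^sub>\<infinity>k. a k * (norm (?g (iterate M T k \<omega>)))\<^sup>2) =
      sqrt (\<Sum>\<^sub>\<infinity>k. a k * (norm (f (iterate M T k \<omega>)))\<^sup>2)"
    by eventually_elim simp
  then show ?thesis
    unfolding orbit_norm_def orbit_integral_def
    by (intro integral_cong_AE meas g f)
qed

end

theory Submission
  imports Defs
begin

text \<open>
  On functions that are constant along the orbits of \<open>T\<close> the norm coincides with the \<open>L\<^sub>1\<close> norm,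
  because the weights \<open>a k\<close> sum to 1, and the \<open>L\<^sub>1\<close> norm is far from rotund at the constant 1:
  if \<open>s\<close> is \<open>1\<close> on a set \<open>A\<close> of measure \<open>1 / 2\<close> and \<open>- 1\<close> off it, then \<open>1 + s\<close>, \<open>1 - s\<close> and \<open>s\<close>
  all have norm 1. Ergodicity excludes an invariant set \<open>A\<close> of measure \<open>1 / 2\<close>, but not an
  almost invariant one, and this is enough for a sequence that violates MLUR at the constant 1.

  Almost invariant sets come from letting a set \<open>B\<close> of small positive measure spread
  (\<open>almost_invariant_half\<close>): the union of the preimages of \<open>B\<close> under the first \<open>n\<close> iterates grows
  by at most the measure of \<open>B\<close> in each step and, by ergodicity, fills the space
  (\<open>ergodic_sweep_out\<close>). Hence it passes measure \<open>1 / 2\<close> with a small overshoot, and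
  \<open>T\<close> moves it by only one such step.

  The norm of the indicator of \<open>A\<close> differs from the measure of \<open>A\<close> by at most the sum over \<open>k\<close> of
  \<open>sqrt (a k)\<close> times the measure of the symmetric difference of \<open>A\<close> and its preimage under \<open>T\<^sup>k\<close>
  (\<open>orbit_integral_indicator_diff_le\<close>). For fixed \<open>k\<close> this measure is at most \<open>\<bar>k\<bar>\<close> times the one
  for \<open>k = 1\<close>, so it tends to 0 along a sequence of ever more invariant sets, and since
  \<open>sqrt (a k)\<close> is summable, so does the sum (\<open>orbit_integral_indicator_tendsto\<close>). As \<open>1 + s\<close>
  and \<open>1 - s\<close> are twice the indicators of \<open>A\<close> and of its complement, both norms tend to 1.
\<close>

section \<open>How far a set is from being invariant\<close>

definition drift :: "'a measure \<Rightarrow> ('a \<Rightarrow> 'a) \<Rightarrow> 'a set \<Rightarrow> 'a set" where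
  "drift M S A = {\<omega> \<in> space M. (S \<omega> \<in> A) \<noteq> (\<omega> \<in> A)}"

lemma sets_drift [measurable]:
  assumes [measurable]: "S \<in> M \<rightarrow>\<^sub>M M" "A \<in> sets M"
  shows "drift M S A \<in> sets M"
  unfolding drift_def by measurable

lemma drift_compl:
  assumes "S \<in> M \<rightarrow>\<^sub>M M"
  shows "drift M S (space M - A) = drift M S A"
  using measurable_space[OF assms] by (auto simp: drift_def)

lemma drift_eq_sym_diff:
  assumes "A \<subseteq> space M"
  shows "drift M S A = ((S -` A \<inter> space M) - A) \<union> (A - (S -` A \<inter> space M))"
  using assms by (auto simp: drift_def)

lemma measure_vimage_preserving:
  assumes "S \<in> M \<rightarrow>\<^sub>M M" "distr M M S = M" "A \<in> sets M"
  shows "measure M (S -` A \<inter> space M) = measure M A"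
  using measure_distr[OF assms(1,3)] assms(2) by simp

context prob_space
begin

text \<open>
  A point that changes sides between times 0 and \<open>n\<close> changes sides in one of the \<open>n\<close> single steps,
  and each of these steps contributes the same measure.
\<close>

lemma measure_drift_funpow:
  assumes S: "S \<in> M \<rightarrow>\<^sub>M M" "distr M M S = M" and A: "A \<in> sets M"
  shows "prob (drift M (S ^^ n) A) \<le> n * prob (drift M S A)"
proof (induction n)
  case 0
  then show ?case by (simp add: drift_def)
next
  case (Suc n)
  note Sn = measurable_distr_funpow[OF S, of n]
  have meas: "drift M S A \<in> sets M" "drift M (S ^^ n) A \<in> sets M"
    using S A Sn by auto
  have "drift M (S ^^ Suc n) A \<subseteq> (S -` drift M (S ^^ n) A \<inter> space M) \<union> drift M S A"
    using measurable_space[OF S(1)] by (auto simp: drift_def funpow_swap1)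
  then have "prob (drift M (S ^^ Suc n) A)
      \<le> prob ((S -` drift M (S ^^ n) A \<inter> space M) \<union> drift M S A)"
    using meas S by (intro finite_measure_mono) auto
  also have "\<dots> \<le> prob (S -` drift M (S ^^ n) A \<inter> space M) + prob (drift M S A)"
    using meas S by (intro measure_Un_le) auto
  also have "prob (S -` drift M (S ^^ n) A \<inter> space M) = prob (drift M (S ^^ n) A)"
    using meas S by (intro measure_vimage_preserving)
  finally show ?case
    using Suc by (simp add: algebra_simps)
qed

lemma measure_drift_iterate:
  assumes T: "invertible_measure_preserving M T" and A: "A \<in> sets M"
  shows "prob (drift M (iterate M T k) A) \<le> \<bar>k\<bar> * prob (drift M T A)"
proof -
  let ?S = "inv_into (space M) T"
  have i1: "iterate M T 1 = T" and i2: "iterate M T (- 1) = ?S"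
    by (simp_all add: iterate_def)
  note T1 = iterate_measure_preserving[OF T, of 1, unfolded i1]
  note S1 = iterate_measure_preserving[OF T, of "- 1", unfolded i2]
  show ?thesis
  proof (cases "0 \<le> k")
    case True
    then show ?thesis
      using measure_drift_funpow[OF T1 A, of "nat k"] by (simp add: iterate_def)
  next
    case False
    have TS: "T (?S \<omega>) = \<omega>" if "\<omega> \<in> space M" for \<omega>
      using T that
      by (auto simp: invertible_measure_preserving_def bij_betw_def intro!: f_inv_into_f)
    have "drift M ?S A = ?S -` drift M T A \<inter> space M"
      using measurable_space[OF S1(1)] TS by (auto simp: drift_def)
    then have "prob (drift M ?S A) = prob (drift M T A)"
      using measure_vimage_preserving[OF S1] T1(1) A by simp
    then show ?thesis
      using False measure_drift_funpow[OF S1 A, of "nat (- k)"] by (simp add: iterate_def)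
  qed
qed

end

section \<open>Almost invariant sets of measure one half\<close>

context prob_space
begin

lemma atomless_small_set:
  assumes "atomless M"
  shows "\<exists>B\<in>sets M. 0 < prob B \<and> prob B \<le> (1 / 2) ^ n"
proof (induction n)
  case 0
  show ?case using prob_space by (intro bexI[of _ "space M"]) auto
next
  case (Suc n)
  then obtain B where B: "B \<in> sets M" "0 < prob B" "prob B \<le> (1 / 2) ^ n"
    by blast
  then obtain C where C: "C \<in> sets M" "C \<subseteq> B" "0 < prob C" "prob C < prob B"
    using assms unfolding atomless_def emeasure_eq_measure
    by (metis ennreal_less_iff ennreal_less_zero_iff measure_nonneg)
  have "prob (B - C) = prob B - prob C"
    using B C by (intro finite_measure_Diff) auto
  show ?case
  proof (cases "prob C \<le> prob B / 2")
    case True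
    then show ?thesis using B C by (intro bexI[of _ C]) auto
  next
    case False
    then show ?thesis
      using B C \<open>prob (B - C) = prob B - prob C\<close> by (intro bexI[of _ "B - C"]) auto
  qed
qed

text \<open>
  The union \<open>E\<close> of all preimages of \<open>B\<close> contains its own preimage, which has the same measure;
  so \<open>E\<close> is invariant up to a null set, and its measure, being positive, is 1.
\<close>

lemma ergodic_sweep_out:
  assumes T: "T \<in> M \<rightarrow>\<^sub>M M" "distr M M T = M" and erg: "ergodic M T"
    and B: "B \<in> sets M" "0 < prob B"
  shows "(\<lambda>n. prob (\<Union>k<n. (T ^^ k) -` B \<inter> space M)) \<longlonglongrightarrow> 1"
proof -
  let ?P = "\<lambda>k. (T ^^ k) -` B \<inter> space M"
  define E where "E = (\<Union>k. ?P k)"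
  have P: "?P k \<in> sets M" for k
    using measurable_distr_funpow[OF T, of k] B by auto
  then have "E \<in> sets M"
    unfolding E_def by (intro sets.countable_UN image_subsetI)
  then have E: "E \<in> sets M" "T -` E \<inter> space M \<in> sets M"
    using measurable_sets[OF T(1)] by blast+
  have sub: "T -` E \<inter> space M \<subseteq> E"
  proof
    fix \<omega> assume "\<omega> \<in> T -` E \<inter> space M"
    then obtain k where "\<omega> \<in> ?P (Suc k)"
      by (auto simp: E_def funpow_swap1)
    then show "\<omega> \<in> E"
      unfolding E_def by (rule UN_I[OF UNIV_I])
  qed
  have "prob (E - (T -` E \<inter> space M)) = prob E - prob (T -` E \<inter> space M)"
    using E sub by (intro finite_measure_Diff)
  also have "\<dots> = 0"
    using measure_vimage_preserving[OF T E(1)] by simp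
  moreover have "(E - (T -` E \<inter> space M)) \<union> ((T -` E \<inter> space M) - E)
      = E - (T -` E \<inter> space M)"
    using sub by blast
  ultimately have "emeasure M ((E - (T -` E \<inter> space M)) \<union> ((T -` E \<inter> space M) - E)) = 0"
    by (simp add: emeasure_eq_measure)
  then have "emeasure M E = 0 \<or> emeasure M E = 1"
    using erg E(1) unfolding ergodic_def by blast
  moreover have "?P 0 = B"
    using B sets.sets_into_space by auto
  then have "B \<subseteq> E"
    unfolding E_def by (metis UN_upper UNIV_I)
  then have "prob B \<le> prob E"
    using E by (intro finite_measure_mono)
  ultimately have E1: "prob E = 1"
    using B by (auto simp: emeasure_eq_measure)
  have "(\<lambda>n. prob (\<Union>k<n. ?P k)) \<longlonglongrightarrow> prob (\<Union>n. \<Union>k<n. ?P k)"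
  proof (rule finite_Lim_measure_incseq)
    show "range (\<lambda>n. \<Union>k<n. ?P k) \<subseteq> sets M"
      by (intro image_subsetI sets.finite_UN P) simp
    show "incseq (\<lambda>n. \<Union>k<n. ?P k)"
      by (intro monoI UN_mono) auto
  qed
  moreover have "(\<Union>n. \<Union>k<n. ?P k) = E"
    unfolding E_def by (simp only: UN_UN_flatten[symmetric] UN_lessThan_UNIV)
  ultimately show ?thesis
    using E1 by simp
qed

text \<open>
  This takes the place of Rokhlin's tower lemma, which would need the orbits to be aperiodic:
  an increasing union that grows in small steps already supplies the set.
\<close>

lemma almost_invariant_half:
  assumes at: "atomless M" and T: "T \<in> M \<rightarrow>\<^sub>M M" "distr M M T = M"
    and erg: "ergodic M T" and e: "0 < \<epsilon>"
  shows "\<exists>A\<in>sets M. 1 / 2 \<le> prob A \<and> prob A \<le> 1 / 2 + \<epsilon> \<and> prob (drift M T A) \<le> 2 * \<epsilon>"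
proof -
  obtain n where "(1 / 2) ^ n < \<epsilon>"
    using real_arch_pow_inv[OF e, of "1 / 2"] by auto
  then obtain B where B: "B \<in> sets M" "0 < prob B" "prob B \<le> \<epsilon>"
    using atomless_small_set[OF at, of n] by force
  let ?P = "\<lambda>k. (T ^^ k) -` B \<inter> space M"
  let ?U = "\<lambda>n. \<Union>k<n. ?P k"
  have P [measurable]: "?P k \<in> sets M" for k
    using measurable_distr_funpow[OF T, of k] B by auto
  have U: "?U n \<in> sets M" for n
    by (intro sets.finite_UN P) simp
  have probP: "prob (?P k) = prob B" for k
    using measurable_distr_funpow[OF T, of k] B by (intro measure_vimage_preserving) auto
  have "\<forall>\<^sub>F n in sequentially. 1 / 2 < prob (?U n)"
    using ergodic_sweep_out[OF T erg B(1,2)] by (rule order_tendstoD) simp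
  then have ex: "\<exists>n. 1 / 2 \<le> prob (?U n)"
    by (auto simp: eventually_sequentially intro: less_imp_le)
  define m where "m = (LEAST n. 1 / 2 \<le> prob (?U n))"
  have m: "1 / 2 \<le> prob (?U m)"
    unfolding m_def using ex by (rule LeastI_ex)
  then have "m \<noteq> 0" by (intro notI) simp
  then obtain l where l: "m = Suc l" by (cases m) auto
  have "\<not> 1 / 2 \<le> prob (?U l)"
    using not_less_Least[of l "\<lambda>n. 1 / 2 \<le> prob (?U n)"] l m_def by auto
  moreover have "prob (?U m) \<le> prob (?U l) + prob (?P l)"
    unfolding l lessThan_Suc UN_insert
    by (subst Un_commute) (intro measure_Un_le U P)
  ultimately have upper: "prob (?U m) \<le> 1 / 2 + \<epsilon>"
    using probP[of l] B(3) by linarith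
  let ?A = "?U m" and ?A' = "T -` ?U m \<inter> space M"
  have sets: "?A \<in> sets M" "?A' \<in> sets M"
    using U measurable_sets[OF T(1)] by blast+
  have "?A' \<subseteq> (\<Union>k<Suc m. ?P k)"
  proof
    fix \<omega> assume "\<omega> \<in> ?A'"
    then obtain k where "k < m" "\<omega> \<in> ?P (Suc k)"
      by (auto simp: funpow_swap1)
    then show "\<omega> \<in> (\<Union>k<Suc m. ?P k)"
      by (intro UN_I[of "Suc k"]) auto
  qed
  then have "?A' - ?A \<subseteq> ?P m"
    unfolding lessThan_Suc UN_insert Diff_subset_conv by (simp only: Un_commute)
  then have "prob (?A' - ?A) \<le> prob (?P m)"
    by (rule finite_measure_mono) (rule P)
  then have d1: "prob (?A' - ?A) \<le> \<epsilon>"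
    using probP[of m] B(3) by simp
  \<comment> \<open>A set and its preimage have equal measure, so they exceed each other equally.\<close>
  have "prob (?A - ?A') = prob ?A - prob (?A \<inter> ?A')"
    using sets by (intro finite_measure_Diff')
  also have "\<dots> = prob ?A' - prob (?A' \<inter> ?A)"
    using measure_vimage_preserving[OF T sets(1)] by (simp add: Int_commute)
  also have "\<dots> = prob (?A' - ?A)"
    using sets by (intro finite_measure_Diff'[symmetric])
  finally have d2: "prob (?A - ?A') = prob (?A' - ?A)" .
  have "prob (drift M T ?A) \<le> prob (?A' - ?A) + prob (?A - ?A')"
    unfolding drift_eq_sym_diff[OF sets.sets_into_space[OF sets(1)]]
    by (intro measure_Un_le sets.Diff sets)
  then show ?thesis
    using sets(1) m upper d1 d2 by (intro bexI[of _ ?A]) auto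
qed

end

section \<open>The norm of the indicator of an almost invariant set\<close>

text \<open>
  This is the reverse triangle inequality in the \<open>l\<^sub>2\<close> space with weights \<open>a\<close>, applied to the
  indicator of \<open>p\<close> and the constant sequence \<open>q\<close>, whose norm is 0 or 1. For two-valued sequences
  it amounts to the subadditivity of the square root.
\<close>

lemma abs_sqrt_infsum_indicator_le:
  fixes a :: "int \<Rightarrow> real"
  assumes a: "\<And>k. 0 \<le> a k" and a1: "(a has_sum 1) UNIV"
  shows "\<bar>sqrt (\<Sum>\<^sub>\<infinity>k. a k * of_bool (p k)) - of_bool q\<bar>
    \<le> sqrt (\<Sum>\<^sub>\<infinity>k. a k * of_bool (p k \<noteq> q))"
proof (cases q)
  case True
  have sum: "(\<lambda>k. a k * of_bool (r k)) summable_on UNIV" for r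
    by (rule summable_on_comparison_test[OF has_sum_imp_summable[OF a1]]) (use a in auto)
  let ?g = "\<Sum>\<^sub>\<infinity>k. a k * of_bool (p k)" and ?g' = "\<Sum>\<^sub>\<infinity>k. a k * of_bool (\<not> p k)"
  have "?g + ?g' = (\<Sum>\<^sub>\<infinity>k. a k * of_bool (p k) + a k * of_bool (\<not> p k))"
    by (rule infsum_add[symmetric]) (rule sum)+
  also have "\<dots> = (\<Sum>\<^sub>\<infinity>k. a k)"
    by (rule infsum_cong) auto
  also have "\<dots> = 1"
    using a1 by (rule infsumI)
  finally have eq: "?g + ?g' = 1" .
  have pos: "0 \<le> ?g" "0 \<le> ?g'"
    using a by (auto intro!: infsum_nonneg)
  have "1 \<le> sqrt ?g + sqrt ?g'"
    using sqrt_add_le_add_sqrt[OF pos] eq by simp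
  moreover have "sqrt ?g \<le> 1"
    using eq pos by simp
  ultimately show ?thesis
    using True by simp
next
  case False
  then show ?thesis
    using a by (simp add: infsum_nonneg)
qed

text \<open>
  Bounding the weighted \<open>l\<^sub>2\<close> norm in the previous lemma by the \<open>l\<^sub>1\<close> norm with weights
  \<open>sqrt (a k)\<close> makes the right-hand side linear, so that it can be integrated term by term.
\<close>

lemma orbit_integral_indicator_diff_le:
  assumes "prob_space M" and T: "invertible_measure_preserving M T"
    and a: "\<And>k. 0 \<le> a k" and a1: "(a has_sum 1) UNIV"
    and sa: "(\<lambda>k. sqrt (a k)) summable_on UNIV" and A: "A \<in> sets M"
  shows "ennreal \<bar>orbit_integral M T a (indicator A :: 'a \<Rightarrow> real) - measure M A\<bar>
    \<le> (\<integral>\<^sup>+k. ennreal (sqrt (a k) * measure M (drift M (iterate M T k) A)) \<partial>count_space UNIV)"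
proof -
  interpret prob_space M by fact
  note [measurable] = A iterate_measure_preserving(1)[OF T]
  let ?h = "\<lambda>\<omega>. sqrt (\<Sum>\<^sub>\<infinity>k. a k * (norm (indicator A (iterate M T k \<omega>) :: real))\<^sup>2)"
  have i1: "integrable M (indicator A :: 'a \<Rightarrow> real)"
    using A by (intro integrable_real_indicator) (auto simp: emeasure_eq_measure)
  have i2: "integrable M ?h"
    by (rule integrable_orbit_sum[OF T a sa i1])
  have "orbit_integral M T a (indicator A :: 'a \<Rightarrow> real) - measure M A
      = (\<integral>\<omega>. ?h \<omega> - indicator A \<omega> \<partial>M)"
    using i1 i2 by (simp add: orbit_integral_def)
  then have "ennreal \<bar>orbit_integral M T a (indicator A :: 'a \<Rightarrow> real) - measure M A\<bar>
      \<le> ennreal (\<integral>\<omega>. \<bar>?h \<omega> - indicator A \<omega>\<bar> \<partial>M)"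
    by (simp add: ennreal_leI integral_abs_bound)
  also have "\<dots> = (\<integral>\<^sup>+\<omega>. ennreal \<bar>?h \<omega> - indicator A \<omega>\<bar> \<partial>M)"
    using i1 i2 by (intro nn_integral_eq_integral[symmetric]) auto
  also have "\<dots> \<le> (\<integral>\<^sup>+\<omega>. (\<integral>\<^sup>+k. ennreal (sqrt (a k) * indicator (drift M (iterate M T k) A) \<omega>)
      \<partial>count_space UNIV) \<partial>M)"
  proof (rule nn_integral_mono)
    fix \<omega> assume \<omega>: "\<omega> \<in> space M"
    have h: "?h \<omega> = sqrt (\<Sum>\<^sub>\<infinity>k. a k * of_bool (iterate M T k \<omega> \<in> A))"
      by (intro arg_cong[where f = sqrt] infsum_cong) (auto simp: indicator_def)
    have "\<bar>?h \<omega> - indicator A \<omega>\<bar>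
        \<le> sqrt (\<Sum>\<^sub>\<infinity>k. a k * of_bool ((iterate M T k \<omega> \<in> A) \<noteq> (\<omega> \<in> A)))"
      unfolding h using abs_sqrt_infsum_indicator_le[OF a a1, of "\<lambda>k. iterate M T k \<omega> \<in> A" "\<omega> \<in> A"]
      by (simp add: indicator_def)
    also have "(\<Sum>\<^sub>\<infinity>k. a k * of_bool ((iterate M T k \<omega> \<in> A) \<noteq> (\<omega> \<in> A)))
        = (\<Sum>\<^sub>\<infinity>k. (sqrt (a k) * indicator (drift M (iterate M T k) A) \<omega>)\<^sup>2)"
      using a \<omega> by (intro infsum_cong) (auto simp: drift_def indicator_def)
    finally show "ennreal \<bar>?h \<omega> - indicator A \<omega>\<bar>
        \<le> (\<integral>\<^sup>+k. ennreal (sqrt (a k) * indicator (drift M (iterate M T k) A) \<omega>)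
          \<partial>count_space UNIV)"
      using sqrt_infsum_squares_le[of "\<lambda>k. sqrt (a k) * indicator (drift M (iterate M T k) A) \<omega>"] a
      by (meson ennreal_leI order_trans mult_nonneg_nonneg real_sqrt_ge_zero indicator_pos_le)
  qed
  also have "\<dots> = (\<integral>\<^sup>+k. (\<integral>\<^sup>+\<omega>. ennreal (sqrt (a k) * indicator (drift M (iterate M T k) A) \<omega>) \<partial>M)
      \<partial>count_space UNIV)"
    by (intro nn_integral_count_space_nn_integral) auto
  also have "\<dots> = (\<integral>\<^sup>+k. ennreal (sqrt (a k) * measure M (drift M (iterate M T k) A))
      \<partial>count_space UNIV)"
    using a by (intro nn_integral_cong)
      (simp add: ennreal_mult ennreal_indicator nn_integral_cmult emeasure_eq_measure)
  finally show ?thesis .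
qed

lemma orbit_integral_indicator_tendsto:
  fixes A :: "nat \<Rightarrow> 'a set"
  assumes "prob_space M" and T: "invertible_measure_preserving M T"
    and a: "\<And>k. 0 \<le> a k" and a1: "(a has_sum 1) UNIV"
    and sa: "(\<lambda>k. sqrt (a k)) summable_on UNIV" and A: "\<And>n. A n \<in> sets M"
    and lim: "(\<lambda>n. measure M (A n)) \<longlonglongrightarrow> c"
    and drift: "(\<lambda>n. measure M (drift M T (A n))) \<longlonglongrightarrow> 0"
  shows "(\<lambda>n. orbit_integral M T a (indicator (A n) :: 'a \<Rightarrow> real)) \<longlonglongrightarrow> c"
proof -
  interpret prob_space M by fact
  let ?d = "\<lambda>n k. sqrt (a k) * measure M (drift M (iterate M T k) (A n))"
  have dk: "(\<lambda>n. measure M (drift M (iterate M T k) (A n))) \<longlonglongrightarrow> 0" for k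
  proof (rule tendsto_sandwich[OF _ _ tendsto_const])
    show "(\<lambda>n. \<bar>k\<bar> * measure M (drift M T (A n))) \<longlonglongrightarrow> 0"
      using tendsto_mult_left[OF drift] by simp
  qed (auto intro!: always_eventually measure_drift_iterate[OF T A])
  have "Infinite_Set_Sum.abs_summable_on (\<lambda>k. sqrt (a k)) UNIV"
    using sa a by (simp add: abs_summable_equivalent[symmetric])
  then have fin: "(\<integral>\<^sup>+k. ennreal (sqrt (a k)) \<partial>count_space UNIV) < \<infinity>"
    using a by (simp add: Infinite_Set_Sum.abs_summable_on_def integrable_iff_bounded)
  have "(\<lambda>n. \<integral>\<^sup>+k. ennreal (?d n k) \<partial>count_space UNIV)
      \<longlonglongrightarrow> (\<integral>\<^sup>+k. 0 \<partial>count_space (UNIV :: int set))"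
  proof (rule nn_integral_dominated_convergence[where w = "\<lambda>k. ennreal (sqrt (a k))"])
    show "AE k in count_space UNIV. ennreal (?d n k) \<le> ennreal (sqrt (a k))" for n
      using a by (intro AE_I2 ennreal_leI) (simp add: mult_left_le)
    show "AE k in count_space UNIV. (\<lambda>n. ennreal (?d n k)) \<longlonglongrightarrow> 0"
      using tendsto_ennrealI[OF tendsto_mult_left[OF dk]] by (intro AE_I2) fastforce
  qed (use fin in auto)
  then have "(\<lambda>n. ennreal \<bar>orbit_integral M T a (indicator (A n) :: 'a \<Rightarrow> real) - measure M (A n)\<bar>)
      \<longlonglongrightarrow> 0"
    unfolding nn_integral_const mult_zero_left
    by (rule tendsto_sandwich[OF _ _ tendsto_const, rotated 2])
      (intro always_eventually allI zero_le
        orbit_integral_indicator_diff_le[OF assms(1) T a a1 sa A])+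
  then have "(\<lambda>n. \<bar>orbit_integral M T a (indicator (A n) :: 'a \<Rightarrow> real) - measure M (A n)\<bar>)
      \<longlonglongrightarrow> 0"
    by (intro tendsto_ennrealD) auto
  then have "(\<lambda>n. orbit_integral M T a (indicator (A n) :: 'a \<Rightarrow> real) - measure M (A n)) \<longlonglongrightarrow> 0"
    by (simp add: tendsto_rabs_zero_iff)
  from tendsto_add[OF this lim] show ?thesis by simp
qed

lemma orbit_integral_scaled_indicator:
  fixes f :: "'a \<Rightarrow> 'b::real_normed_vector"
  assumes "\<And>\<omega>. norm (f \<omega>) = c * indicator A \<omega>" "0 \<le> c"
  shows "orbit_integral M T a f = c * orbit_integral M T a (indicator A :: 'a \<Rightarrow> real)"
proof -
  have "(\<Sum>\<^sub>\<infinity>k. a k * (norm (f (iterate M T k \<omega>)))\<^sup>2)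
      = c\<^sup>2 * (\<Sum>\<^sub>\<infinity>k. a k * (norm (indicator A (iterate M T k \<omega>) :: real))\<^sup>2)" for \<omega>
    by (subst infsum_cmult_right'[symmetric])
      (simp add: assms(1) power_mult_distrib mult_ac)
  then show ?thesis
    using assms(2) by (simp add: orbit_integral_def real_sqrt_mult)
qed

section \<open>Failure of rotundity\<close>

text \<open>
  Only the numbers 1 and \<open>- 1\<close> and their sum and differences occur as function values, which is
  why one argument covers the real and the complex space.
\<close>

lemma orbit_norm_not_MLUR:
  fixes M :: "'a measure"
  assumes "prob_space M" and at: "atomless M" and T: "invertible_measure_preserving M T"
    and erg: "ergodic M T" and a: "\<And>k. 0 \<le> a k" and a1: "(a has_sum 1) UNIV"
    and sa: "(\<lambda>k. sqrt (a k)) summable_on UNIV"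
  shows "\<not> MLUR (L1 M :: ('a \<Rightarrow> 'b::{banach, second_countable_topology, real_normed_algebra_1}) set set)
    (L1_add M) (L1_diff M) (orbit_norm M T a)"
proof
  interpret prob_space M by fact
  assume MLUR: "MLUR (L1 M :: ('a \<Rightarrow> 'b) set set) (L1_add M) (L1_diff M) (orbit_norm M T a)"
  have "iterate M T 1 = T"
    by (simp add: iterate_def)
  with iterate_measure_preserving[OF T, of 1] have T1: "T \<in> M \<rightarrow>\<^sub>M M" "distr M M T = M"
    by simp_all
  have "\<forall>n. \<exists>A\<in>sets M. 1 / 2 \<le> prob A \<and> prob A \<le> 1 / 2 + 1 / Suc n \<and>
      prob (drift M T A) \<le> 2 * (1 / Suc n)"
    by (intro allI almost_invariant_half[OF at T1 erg]) simp
  then obtain A where A: "\<And>n. A n \<in> sets M" "\<And>n. 1 / 2 \<le> prob (A n)"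
      "\<And>n. prob (A n) \<le> 1 / 2 + 1 / Suc n" "\<And>n. prob (drift M T (A n)) \<le> 2 * (1 / Suc n)"
    by metis
  note lim0 = LIMSEQ_Suc[OF lim_1_over_n[where 'a = real]]
  have lim: "(\<lambda>n. prob (A n)) \<longlonglongrightarrow> 1 / 2"
  proof (rule tendsto_sandwich[OF _ _ tendsto_const])
    show "(\<lambda>n. 1 / 2 + 1 / real (Suc n)) \<longlonglongrightarrow> 1 / 2"
      using tendsto_add[OF tendsto_const[of "1 / 2"] lim0] by simp
  qed (intro always_eventually allI A)+
  have drift: "(\<lambda>n. prob (drift M T (A n))) \<longlonglongrightarrow> 0"
  proof (rule tendsto_sandwich[OF _ _ tendsto_const])
    show "(\<lambda>n. 2 * (1 / real (Suc n))) \<longlonglongrightarrow> 0"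
      using tendsto_mult_left[OF lim0, of 2] by simp
  qed (intro always_eventually allI A measure_nonneg)+
  have lim': "(\<lambda>n. prob (space M - A n)) \<longlonglongrightarrow> 1 / 2"
    using tendsto_diff[OF tendsto_const[of 1] lim] A(1) by (simp add: prob_compl)
  define one :: "'a \<Rightarrow> 'b" where "one = (\<lambda>_. 1)"
  define s :: "nat \<Rightarrow> 'a \<Rightarrow> 'b" where "s n = (\<lambda>\<omega>. if \<omega> \<in> A n then 1 else - 1)" for n
  have one: "integrable M one"
    by (simp add: one_def)
  have s: "integrable M (s n)" for n
    unfolding s_def using A(1)[of n] by (intro integrable_const_bound[where B = 1]) auto
  have unit: "orbit_integral M T a f = 1" if "\<And>\<omega>. norm (f \<omega>) = 1" for f :: "'a \<Rightarrow> 'b"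
    using infsumI[OF a1] by (simp add: orbit_integral_def that prob_space)
  have plus: "(\<lambda>n. orbit_norm M T a (L1_add M (L1_class M one) (L1_class M (s n)))) \<longlonglongrightarrow> 1"
  proof -
    have "norm (one \<omega> + s n \<omega>) = 2 * indicator (A n) \<omega>" for n \<omega>
      by (auto simp: one_def s_def indicator_def)
    then have "orbit_norm M T a (L1_add M (L1_class M one) (L1_class M (s n)))
        = 2 * orbit_integral M T a (indicator (A n) :: 'a \<Rightarrow> real)" for n
      unfolding L1_add_class[OF one s] using one s
      by (subst orbit_norm_class[OF T a]) (auto intro: orbit_integral_scaled_indicator)
    moreover have "(\<lambda>n. orbit_integral M T a (indicator (A n) :: 'a \<Rightarrow> real)) \<longlonglongrightarrow> 1 / 2"
      by (rule orbit_integral_indicator_tendsto[OF assms(1) T a a1 sa A(1) lim drift])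
    ultimately show ?thesis
      using tendsto_mult_left[of _ "1 / 2" sequentially "2 :: real"] by simp
  qed
  have minus: "(\<lambda>n. orbit_norm M T a (L1_diff M (L1_class M one) (L1_class M (s n)))) \<longlonglongrightarrow> 1"
  proof -
    have "norm (one \<omega> - s n \<omega>) = 2 * indicator (- A n) \<omega>" for n \<omega>
      by (auto simp: one_def s_def indicator_def)
    then have "orbit_norm M T a (L1_diff M (L1_class M one) (L1_class M (s n)))
        = 2 * orbit_integral M T a (indicator (- A n) :: 'a \<Rightarrow> real)" for n
      unfolding L1_diff_class[OF one s] using one s
      by (subst orbit_norm_class[OF T a]) (auto intro: orbit_integral_scaled_indicator)
    \<comment> \<open>The complement is taken in the whole type here, but orbits stay in the space.\<close>
    moreover have "orbit_integral M T a (indicator (- A n) :: 'a \<Rightarrow> real)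
        = orbit_integral M T a (indicator (space M - A n) :: 'a \<Rightarrow> real)" for n
      unfolding orbit_integral_def
      using measurable_space[OF iterate_measure_preserving(1)[OF T]]
      by (intro Bochner_Integration.integral_cong refl arg_cong[where f = sqrt] infsum_cong)
        (auto simp: indicator_def)
    moreover have "(\<lambda>n. orbit_integral M T a (indicator (space M - A n) :: 'a \<Rightarrow> real)) \<longlonglongrightarrow> 1 / 2"
      using A(1) lim' drift drift_compl[OF T1(1)]
      by (intro orbit_integral_indicator_tendsto[OF assms(1) T a a1 sa]) auto
    ultimately show ?thesis
      using tendsto_mult_left[of _ "1 / 2" sequentially "2 :: real"] by simp
  qed
  have "(\<lambda>n. orbit_norm M T a (L1_class M (s n))) \<longlonglongrightarrow> 0"
  proof -
    have L1: "L1_class M f \<in> L1 M" if "integrable M f" for f :: "'a \<Rightarrow> 'b"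
      using that unfolding L1_def L1_class_def by (intro quotientI) simp
    have "orbit_norm M T a (L1_class M one) = 1"
      unfolding orbit_norm_class[OF T a one] by (rule unit) (simp add: one_def)
    with MLUR[unfolded MLUR_def, rule_format, OF L1[OF one] _ L1[OF s] plus minus]
    show ?thesis by simp
  qed
  moreover have "orbit_norm M T a (L1_class M (s n)) = 1" for n
    unfolding orbit_norm_class[OF T a s] by (rule unit) (simp add: s_def)
  ultimately show False
    by (simp add: LIMSEQ_const_iff)
qed

theorem mainTheorem8:
  fixes M :: "'a measure" and T :: "'a \<Rightarrow> 'a" and a :: "int \<Rightarrow> real"
  assumes "prob_space M"
    and "atomless M"
    and "invertible_measure_preserving M T"
    and "ergodic M T"
    and "\<And>k. 0 < a k"
    and "(a has_sum 1) UNIV"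
    and "(\<lambda>k. sqrt (a k)) summable_on UNIV"
  shows "\<not> MLUR (L1 M :: ('a \<Rightarrow> real) set set) (L1_add M) (L1_diff M) (orbit_norm M T a) \<and>
    \<not> MLUR (L1 M :: ('a \<Rightarrow> complex) set set) (L1_add M) (L1_diff M) (orbit_norm M T a)"
  by (intro conjI orbit_norm_not_MLUR[OF assms(1-4) less_imp_le[OF assms(5)] assms(6,7)])

end
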